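(* For every $\phi\in C^\infty(B_R)$, one has $$\left(\int_{B_R}|\nabla\phi|^2\,dx\right)\left(\int_{B_R}x_n^2|\phi|^2\,dx\right)\ \ge\ \frac14\left(\int_{B_R}|\phi|^2\,dx-\int_{\partial B_R}x_n^2|\phi|^2\,d\nu\right)^2.$$
   Context: $B_R=\{x\in\mathbb{R}^n:|x|<R\}$ is the open ball of radius $R$ centered at the origin, $x=(x_1,\dots,x_n)$, $\partial B_R=\{x\in\mathbb{R}^n:|x|=R\}$ is the boundary sphere, and $d\nu$ is the surface measure on $\partial B_R$.
   Formalization: The boundary integral is multiplied by 1/R (as printed the inequality fails for every R ≠ 1, e.g. for φ = 1), and φ is also assumed continuous on the closed ball so that the integral over ∂B_R is defined. *)

theory Defs
  imports "HOL-Analysis.Analysis"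
begin

definition partial_deriv :: "'n::finite \<Rightarrow> (real ^ 'n \<Rightarrow> 'b::real_normed_vector) \<Rightarrow> real ^ 'n \<Rightarrow> 'b" where
  "partial_deriv i f x = frechet_derivative f (at x) (axis i 1)"

definition gradient :: "(real ^ 'n::finite \<Rightarrow> 'b::real_normed_vector) \<Rightarrow> real ^ 'n \<Rightarrow> 'b ^ 'n" where
  "gradient f x = (\<chi> i. partial_deriv i f x)"

text \<open>Meant for open \<open>S\<close> only, since derivatives are taken in the full space.\<close>

fun Ck_on :: "nat \<Rightarrow> (real ^ 'n::finite) set \<Rightarrow> (real ^ 'n \<Rightarrow> 'b::real_normed_vector) \<Rightarrow> bool" where
  "Ck_on 0 S f \<longleftrightarrow> continuous_on S f"
| "Ck_on (Suc m) S f \<longleftrightarrow>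
     (\<forall>x\<in>S. f differentiable (at x)) \<and> (\<forall>i. Ck_on m S (partial_deriv i f))"

definition smooth_on :: "(real ^ 'n::finite) set \<Rightarrow> (real ^ 'n \<Rightarrow> 'b::real_normed_vector) \<Rightarrow> bool" where
  "smooth_on S f \<longleftrightarrow> (\<forall>m. Ck_on m S f)"

text \<open>The surface measure on the sphere of radius \<open>R > 0\<close> about the origin: in dimension \<open>n\<close> a
  Borel set \<open>A\<close> of the sphere has measure \<open>n / R\<close> times the Lebesgue measure of the open cone
  \<open>{t x | 0 < t < 1, x \<in> A}\<close>. In dimension 1 this is the counting measure on \<open>{- R, R}\<close>. The cone
  over \<open>A\<close> is the preimage of \<open>A\<close> under the radial projection of the punctured ball.\<close>

definition sphere_measure :: "real \<Rightarrow> 'a::euclidean_space measure" where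
  "sphere_measure R =
     scale_measure (ennreal (real DIM('a) / R))
       (distr (restrict_space lborel (ball 0 R - {0})) (restrict_space borel (sphere 0 R))
         (\<lambda>x. (R / norm x) *\<^sub>R x))"

lemma space_sphere_measure [simp]: "space (sphere_measure R) = sphere 0 R"
  by (simp add: sphere_measure_def space_scale_measure space_restrict_space)

lemma sets_sphere_measure [measurable_cong, simp]:
  "sets (sphere_measure R) = sets (restrict_space borel (sphere 0 R))"
  by (simp add: sphere_measure_def)

lemma measurable_radial_projection:
  assumes "R > 0"
  shows "(\<lambda>x. (R / norm x) *\<^sub>R x) \<in> restrict_space lborel (ball 0 R - {0})
           \<rightarrow>\<^sub>M restrict_space borel (sphere 0 R :: 'a::euclidean_space set)"
proof (rule measurable_restrict_space2)
  show "(\<lambda>x. (R / norm x) *\<^sub>R x) \<in> space (restrict_space lborel (ball 0 R - {0})) \<rightarrow> (sphere 0 R :: 'a set)"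
    using assms by (auto simp: space_restrict_space)
  show "(\<lambda>x. (R / norm x) *\<^sub>R x) \<in> restrict_space lborel (ball 0 R - {0}) \<rightarrow>\<^sub>M (borel :: 'a measure)"
    by (rule measurable_restrict_space1) measurable
qed

lemma emeasure_sphere_measure_cone:
  fixes A :: "'a::euclidean_space set"
  assumes "R > 0" "A \<in> sets borel" "A \<subseteq> sphere 0 R"
  shows "emeasure (sphere_measure R) A =
    ennreal (real DIM('a) / R) * emeasure lborel {t *\<^sub>R x | t x. 0 < t \<and> t < 1 \<and> x \<in> A}"
proof -
  have A: "A \<in> sets (restrict_space borel (sphere 0 R))"
    using assms by (simp add: sets_restrict_space_iff)
  have eq: "(\<lambda>x. (R / norm x) *\<^sub>R x) -` A \<inter> (ball 0 R - {0}) =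
      {t *\<^sub>R x | t x. 0 < t \<and> t < 1 \<and> x \<in> A}" (is "?L = ?C")
  proof (intro equalityI subsetI)
    fix y assume y: "y \<in> ?L"
    have "y = (norm y / R) *\<^sub>R ((R / norm y) *\<^sub>R y)" "0 < norm y / R" "norm y / R < 1"
      using y assms(1) by auto
    with y show "y \<in> ?C" by blast
  next
    fix y assume "y \<in> ?C"
    then obtain t x where "y = t *\<^sub>R x" "0 < t" "t < 1" "x \<in> A" by blast
    moreover from this have "norm x = R" using assms(3) by auto
    ultimately show "y \<in> ?L" using assms(1) by auto
  qed
  have sub: "{t *\<^sub>R x | t x. 0 < t \<and> t < 1 \<and> x \<in> A} \<subseteq> ball 0 R - {0}"
    using eq by blast
  show ?thesis
    unfolding sphere_measure_def
    by (simp add: emeasure_distr[OF measurable_radial_projection[OF assms(1)] A]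
        space_restrict_space emeasure_restrict_space eq sub)
qed

lemma emeasure_sphere_measure_sphere:
  assumes "R > 0"
  shows "emeasure (sphere_measure R) (sphere 0 R :: 'a::euclidean_space set) =
    ennreal (real DIM('a) * unit_ball_vol (real DIM('a)) * R ^ (DIM('a) - 1))"
proof -
  have S: "(sphere 0 R :: 'a set) \<in> sets (restrict_space borel (sphere 0 R))"
    using sets.top[of "restrict_space borel (sphere 0 R :: 'a set)"]
    by (simp add: space_restrict_space)
  have eq: "(\<lambda>x. (R / norm x) *\<^sub>R x) -` (sphere 0 R :: 'a set) \<inter> (ball 0 R - {0}) = ball 0 R - {0}"
    using assms by auto
  have "emeasure lborel (ball 0 R - {0::'a}) = emeasure lborel (ball (0::'a) R)"
    by (subst emeasure_Diff_null_set) auto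
  also have "\<dots> = ennreal (unit_ball_vol (real DIM('a)) * R ^ DIM('a))"
    using assms by (simp add: emeasure_ball)
  finally have "emeasure (sphere_measure R) (sphere 0 R :: 'a set) =
      ennreal (real DIM('a) / R) * ennreal (unit_ball_vol (real DIM('a)) * R ^ DIM('a))"
    unfolding sphere_measure_def
    by (simp add: emeasure_distr[OF measurable_radial_projection[OF assms] S]
        space_restrict_space emeasure_restrict_space eq)
  also have "\<dots> = ennreal (real DIM('a) / R * (unit_ball_vol (real DIM('a)) * R ^ DIM('a)))"
    using assms by (intro ennreal_mult[symmetric]) auto
  also have "real DIM('a) / R * (unit_ball_vol (real DIM('a)) * R ^ DIM('a)) =
      real DIM('a) * unit_ball_vol (real DIM('a)) * R ^ (DIM('a) - 1)"
    using assms by (simp add: power_diff)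
  finally show ?thesis .
qed

end

theory Submission
  imports Defs
begin

text \<open>
  The divergence theorem for the field \<open>F e\<^sub>k\<close>, \<open>F = x\<^sub>k |\<phi>|\<^sup>2\<close>, on the ball turns
  \<open>\<integral> |\<phi>|\<^sup>2 dx - \<integral> x\<^sub>k\<^sup>2 |\<phi>|\<^sup>2 d\<nu> / R\<close> into \<open>- 2 \<integral> x\<^sub>k Re (cnj \<phi> \<partial>\<^sub>k \<phi>) dx\<close>, and the
  Cauchy-Schwarz inequality finishes. As \<open>\<phi>\<close> is only continuous up to the boundary, the
  divergence theorem is obtained by integrating \<open>(r\<^sup>2 - |x|\<^sup>2) F\<close>, which vanishes on the sphere of radius \<open>r\<close>: extended by
  zero it is Lipschitz, so by translation invariance of Lebesgue measure its directional derivative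
  has integral zero. Taking the difference quotient of the resulting identity between the radii
  \<open>r < R\<close> and \<open>R\<close> and letting \<open>r\<close> tend to \<open>R\<close> produces the volume integral
  on one side and, by shell averaging, the integral over the sphere on the other.\<close>

section \<open>Directional derivatives of Lipschitz functions with bounded support\<close>

lemma set_integrable_cball_subset:
  fixes f :: "'a::euclidean_space \<Rightarrow> real"
  assumes "continuous_on (cball 0 R) f" "A \<subseteq> cball 0 R" "A \<in> sets borel"
  shows "set_integrable lborel A f"
proof -
  have "compact (cball (0::'a) R)" by simp
  from borel_integrable_compact[OF this assms(1)]
  have "set_integrable lborel (cball 0 R) f" unfolding set_integrable_def .
  then show ?thesis by (rule set_integrable_subset) (use assms in auto)
qed

lemma lborel_integral_translation:
  fixes f :: "'a::euclidean_space \<Rightarrow> real"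
  assumes [measurable]: "f \<in> borel_measurable borel"
  shows "(LINT x|lborel. f (x + c)) = (LINT x|lborel. f x)"
proof -
  have "(LINT x|lborel. f x) = (LINT x|distr lborel borel ((+) c). f x)"
    by (simp add: lborel_distr_plus)
  also have "\<dots> = (LINT x|lborel. f (x + c))"
    by (subst integral_distr) (auto simp: add.commute)
  finally show ?thesis ..
qed

text \<open>By translation invariance every difference quotient along \<open>e\<close> integrates to
  zero. The Lipschitz bound and the bounded support provide an integrable majorant, so dominated
  convergence carries this over to the derivative, which need only exist almost everywhere.\<close>

lemma integral_directional_derivative_eq_0:
  fixes f :: "'a::euclidean_space \<Rightarrow> real"
  assumes lip: "L-lipschitz_on UNIV f"
    and supp: "\<And>x. norm x > r \<Longrightarrow> f x = 0"
    and meas: "f' \<in> borel_measurable borel"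
    and deriv: "AE x in lborel. ((\<lambda>t. f (x + t *\<^sub>R e)) has_real_derivative f' x) (at 0)"
  shows "(LINT x|lborel. f' x) = 0"
proof -
  define t where "t m = inverse (real (Suc m))" for m
  define s where "s m x = (f (x + t m *\<^sub>R e) - f x) / t m" for m x
  have t: "0 < t m" "t m \<le> 1" for m
    by (auto simp: t_def divide_simps)
  have t0: "filterlim t (at 0) sequentially"
    unfolding t_def filterlim_at using LIMSEQ_inverse_real_of_nat by auto
  have cont: "continuous_on UNIV f"
    using lip by (rule lipschitz_on_continuous_on)
  then have [measurable]: "f \<in> borel_measurable borel"
    by (rule borel_measurable_continuous_onI)
  have "compact (cball (0::'a) r)" by simp
  then have int: "integrable lborel (\<lambda>x. indicator (cball 0 r) x *\<^sub>R f x)"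
    by (rule borel_integrable_compact) (rule continuous_on_subset[OF cont], simp)
  have eq: "(\<lambda>x. indicator (cball 0 r) x *\<^sub>R f x) = f"
    using supp by (auto simp: fun_eq_iff indicator_def)
  have intf: "integrable lborel f"
    using int unfolding eq .
  have intt: "integrable lborel (\<lambda>x. f (x + c))" for c
  proof -
    have "integrable (distr lborel borel ((+) c)) f"
      using intf by (simp add: lborel_distr_plus)
    then show ?thesis
      by (subst (asm) integrable_distr_eq) (auto simp: add.commute)
  qed
  have "(LINT x|lborel. s m x) = 0" for m
    unfolding s_def using intf intt lborel_integral_translation[of f] by simp
  moreover have "(\<lambda>m. LINT x|lborel. s m x) \<longlonglongrightarrow> (LINT x|lborel. f' x)"
  proof (rule integral_dominated_convergence)
    show "f' \<in> borel_measurable lborel" using meas by simp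
    show "s m \<in> borel_measurable lborel" for m unfolding s_def by measurable
    \<comment> \<open>Since \<open>t m\<close> is at most 1, a shift by
      \<open>t m *\<^sub>R e\<close> moves the support by at most \<open>norm e\<close>; the
      enlarged ball therefore serves all \<open>m\<close> at once.\<close>
    show "integrable lborel (\<lambda>x. (L * norm e) * indicator (cball 0 (r + norm e)) x)"
      using emeasure_lborel_cball_finite by (intro integrable_mult_right integrable_real_indicator) auto
    show "AE x in lborel. (\<lambda>m. s m x) \<longlonglongrightarrow> f' x"
      using deriv
    proof eventually_elim
      case (elim x)
      then have "((\<lambda>h. (f (x + h *\<^sub>R e) - f x) / h) \<longlongrightarrow> f' x) (at 0)"
        by (simp add: DERIV_def)
      from filterlim_compose[OF this t0] show ?case by (simp add: s_def)
    qed
    show "AE x in lborel. norm (s m x) \<le> L * norm e * indicator (cball 0 (r + norm e)) x" for m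
    proof (rule AE_I2)
      fix x
      show "norm (s m x) \<le> L * norm e * indicator (cball 0 (r + norm e)) x"
      proof (cases "norm x \<le> r + norm e")
        case True
        have "\<bar>f (x + t m *\<^sub>R e) - f x\<bar> \<le> L * norm (t m *\<^sub>R e)"
          using lipschitz_on_normD[OF lip, of "x + t m *\<^sub>R e" x] by simp
        then show ?thesis
          using True t[of m] by (simp add: s_def divide_simps mult_ac)
      next
        case False
        have "norm (t m *\<^sub>R e) \<le> norm e"
          using t[of m] by (simp add: mult_left_le_one_le)
        then have "norm (x + t m *\<^sub>R e) > r"
          using False norm_triangle_ineq4[of "x + t m *\<^sub>R e" "t m *\<^sub>R e"] by simp
        moreover have "norm x > r"
          using False norm_ge_zero[of e] by linarith
        ultimately show ?thesis using False supp by (simp add: s_def)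
      qed
    qed
  qed
  ultimately show ?thesis by (simp add: LIMSEQ_const_iff)
qed

section \<open>Derivative bounds from continuous partial derivatives\<close>

text \<open>The partial derivatives are bounded by compactness, hence so is the operator norm of the
  derivative, and convexity allows the mean value inequality. This supplies the Lipschitz constant
  of the weighted function on a closed inner ball.\<close>

lemma lipschitz_on_compact_convex_of_C1:
  fixes F :: "'a::euclidean_space \<Rightarrow> real"
  assumes K: "compact K" "convex K"
    and deriv: "\<And>x. x \<in> K \<Longrightarrow> (F has_derivative F' x) (at x)"
    and cont: "\<And>b. b \<in> Basis \<Longrightarrow> continuous_on K (\<lambda>x. F' x b)"
  obtains L where "L-lipschitz_on K F"
proof -
  have "\<exists>M. \<forall>x\<in>K. \<bar>F' x b\<bar> \<le> M" if b: "b \<in> Basis" for b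
  proof -
    have "bounded ((\<lambda>x. F' x b) ` K)"
      using K cont[OF b] by (intro compact_imp_bounded compact_continuous_image)
    then show ?thesis by (auto simp: bounded_iff)
  qed
  then obtain M where M: "\<And>b x. b \<in> Basis \<Longrightarrow> x \<in> K \<Longrightarrow> \<bar>F' x b\<bar> \<le> M b"
    by metis
  \<comment> \<open>The absolute value keeps \<open>B\<close> nonnegative even for empty
    \<open>K\<close>, where nothing constrains the values \<open>M b\<close>.\<close>
  define B where "B = \<bar>\<Sum>b\<in>Basis. M b\<bar>"
  have "onorm (F' x) \<le> B" if x: "x \<in> K" for x
  proof (rule onorm_bound)
    show "B \<ge> 0" by (simp add: B_def)
    fix v :: 'a
    interpret linear "F' x" using deriv[OF x] by (rule has_derivative_linear)
    have "F' x v = (\<Sum>b\<in>Basis. (v \<bullet> b) * F' x b)"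
      by (subst euclidean_representation[of v, symmetric]) (simp add: sum scale)
    then have "\<bar>F' x v\<bar> \<le> (\<Sum>b\<in>Basis. \<bar>(v \<bullet> b) * F' x b\<bar>)"
      by (simp add: sum_abs)
    also have "\<dots> \<le> (\<Sum>b\<in>Basis. norm v * M b)"
      unfolding abs_mult using M[OF _ x] by (intro sum_mono mult_mono Basis_le_norm) auto
    also have "\<dots> \<le> B * norm v"
      unfolding B_def sum_distrib_left[symmetric]
      by (simp add: mult.commute mult_left_mono)
    finally show "norm (F' x v) \<le> B * norm v" by simp
  qed
  then have "B-lipschitz_on K F"
    using deriv
    by (intro lipschitz_onI)
       (auto simp: dist_norm B_def intro!: differentiable_bound[OF K(2), of F F', unfolded real_norm_def]
          intro: has_derivative_at_withinI)
  then show ?thesis by (rule that)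
qed

lemma continuous_on_derivative_direction:
  fixes F' :: "'b::topological_space \<Rightarrow> 'a::euclidean_space \<Rightarrow> real"
  assumes lin: "\<And>x. x \<in> S \<Longrightarrow> linear (F' x)"
    and cont: "\<And>b. b \<in> Basis \<Longrightarrow> continuous_on S (\<lambda>x. F' x b)"
  shows "continuous_on S (\<lambda>x. F' x e)"
proof -
  have "continuous_on S (\<lambda>x. \<Sum>b\<in>Basis. (e \<bullet> b) * F' x b)"
    using cont by (intro continuous_intros) auto
  moreover have "F' x e = (\<Sum>b\<in>Basis. (e \<bullet> b) * F' x b)" if "x \<in> S" for x
  proof -
    interpret linear "F' x" using lin[OF that] .
    show ?thesis
      by (subst euclidean_representation[of e, symmetric]) (simp add: sum scale)
  qed
  ultimately show ?thesis by (simp cong: continuous_on_cong)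
qed

section \<open>The weighted divergence identity on balls\<close>

text \<open>The two integrands differ by the derivative along \<open>e\<close> of the weight times
  \<open>F\<close>, because the weight has derivative \<open>- 2 * (x \<bullet> e)\<close>. As the
  weight vanishes on the sphere of radius \<open>r\<close>, no boundary term arises. Taking
  \<open>r < R\<close> keeps the closed ball inside the region where \<open>F\<close> is
  continuously differentiable.\<close>

lemma weighted_divergence_inner_ball:
  fixes F :: "'a::euclidean_space \<Rightarrow> real"
  assumes r: "0 \<le> r" "r < R"
    and deriv: "\<And>x. x \<in> ball 0 R \<Longrightarrow> (F has_derivative F' x) (at x)"
    and cont: "\<And>b. b \<in> Basis \<Longrightarrow> continuous_on (ball 0 R) (\<lambda>x. F' x b)"
  shows "(LINT x:ball 0 r|lborel. (r\<^sup>2 - (norm x)\<^sup>2) * F' x e) =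
         (LINT x:ball 0 r|lborel. 2 * (x \<bullet> e) * F x)"
proof -
  let ?K = "cball 0 r :: 'a set"
  have K: "?K \<subseteq> ball 0 R" using r by auto
  define p where "p = closest_point ?K"
  define H where "H x = (r\<^sup>2 - (norm x)\<^sup>2) * F x" for x
  define H' where "H' x v = (r\<^sup>2 - (norm x)\<^sup>2) * F' x v - 2 * (x \<bullet> v) * F x" for x v
  \<comment> \<open>Since \<open>H\<close> vanishes on the sphere, this is its extension by zero; in this form the Lipschitz bound
    carries over because the projection \<open>p\<close> is 1-Lipschitz.\<close>
  define f where "f x = H (p x)" for x
  have derivH: "(H has_derivative H' x) (at x)" if "x \<in> ball 0 R" for x
    unfolding H_def[abs_def] H'_def[abs_def] power2_norm_eq_inner
    by (rule derivative_eq_intros deriv[OF that] refl)+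
       (auto simp: fun_eq_iff algebra_simps inner_commute)
  have contF: "continuous_on (ball 0 R) F"
    using deriv by (meson continuous_at_imp_continuous_on has_derivative_continuous)
  have contH': "continuous_on ?K (\<lambda>x. H' x b)" if "b \<in> Basis" for b
    unfolding H'_def
    by (intro continuous_intros continuous_on_subset[OF cont[OF that] K]
        continuous_on_subset[OF contF K])
  have contF'e: "continuous_on (ball 0 R) (\<lambda>x. F' x e)"
    by (rule continuous_on_derivative_direction[OF has_derivative_linear[OF deriv] cont])
  obtain L where L: "L-lipschitz_on ?K H"
    by (rule lipschitz_on_compact_convex_of_C1[OF _ _ derivH contH']) (use K in auto)
  have p: "p x \<in> ?K" for x
    unfolding p_def using r by (intro closest_point_in_set) auto
  have lipp: "1-lipschitz_on UNIV p"
    unfolding p_def using r by (intro lipschitz_onI) (auto intro!: closest_point_lipschitz)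
  have "(L * 1)-lipschitz_on UNIV f"
    unfolding f_def
    by (rule lipschitz_on_compose2[OF lipp]) (rule lipschitz_on_subset[OF L], use p in auto)
  then have lipf: "L-lipschitz_on UNIV f" by simp
  have f_out: "f x = 0" if "norm x \<ge> r" for x
  proof -
    \<comment> \<open>The radial point \<open>z\<close> of the closed ball already attains this
      distance, so the closest point does at least as well. By the triangle inequality
      \<open>p x\<close> then has norm \<open>r\<close>, where the weight is zero. The remaining
      case \<open>x = 0\<close> forces \<open>r = 0\<close>.\<close>
    have "dist x (p x) \<le> norm x - r"
    proof (cases "x = 0")
      case False
      define z where "z = (r / norm x) *\<^sub>R x"
      have "z \<in> ?K" using r by (simp add: z_def)
      then have "dist x (p x) \<le> dist x z"
        unfolding p_def by (intro closest_point_le) auto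
      also have "x - z = (1 - r / norm x) *\<^sub>R x"
        by (simp add: z_def scaleR_diff_left)
      then have "dist x z = norm x - r"
        using that False by (simp add: dist_norm left_diff_distrib)
      finally show ?thesis .
    qed (use that r in \<open>simp add: p_def closest_point_self\<close>)
    then have "r \<le> norm (p x)"
      using norm_triangle_ineq2[of x "p x"] norm_triangle_ineq2[of x "x - p x"]
      by (simp add: dist_norm)
    then have "norm (p x) = r" using p[of x] by simp
    then show ?thesis by (simp add: f_def H_def)
  qed
  have f_in: "f x = H x" if "norm x \<le> r" for x
    using that by (simp add: f_def p_def closest_point_self)
  define f' where "f' x = indicator (ball 0 r) x * H' x e" for x
  have sub: "ball 0 r \<subseteq> ball 0 R" using r by auto
  have contA: "continuous_on ?K (\<lambda>x. (r\<^sup>2 - (norm x)\<^sup>2) * F' x e)"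
    by (intro continuous_intros continuous_on_subset[OF contF'e K])
  have contB: "continuous_on ?K (\<lambda>x. 2 * (x \<bullet> e) * F x)"
    by (intro continuous_intros continuous_on_subset[OF contF K])
  have int: "set_integrable lborel (ball 0 r) g" if "continuous_on ?K g" for g :: "'a \<Rightarrow> real"
    by (rule set_integrable_cball_subset[OF that]) auto
  have "(LINT x|lborel. f' x) = 0"
  proof (rule integral_directional_derivative_eq_0[OF lipf])
    show "f x = 0" if "norm x > r" for x using f_out that by simp
    have "continuous_on (ball 0 r) (\<lambda>x. H' x e)"
      unfolding H'_def
      by (intro continuous_intros continuous_on_subset[OF contF'e sub] continuous_on_subset[OF contF sub])
    then show "f' \<in> borel_measurable borel"
      using borel_measurable_continuous_on_indicator[of "ball 0 r" "\<lambda>x. H' x e"]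
      unfolding f'_def by simp
    \<comment> \<open>On the sphere itself the extension by zero may have a kink, so these points
      are discarded as a null set; off the sphere \<open>f\<close> agrees locally with
      \<open>H\<close> or with 0.\<close>
    have "sphere 0 r \<in> null_sets (lborel :: 'a measure)"
      using negligible_sphere[of 0 r]
      by (auto simp: null_sets_completion_iff negligible_iff_null_sets)
    then have "AE x in lborel. x \<notin> sphere (0::'a) r" by (rule AE_not_in)
    then show "AE x in lborel. ((\<lambda>t. f (x + t *\<^sub>R e)) has_real_derivative f' x) (at 0)"
    proof eventually_elim
      case (elim x)
      have line: "((\<lambda>t::real. x + t *\<^sub>R e) \<longlongrightarrow> x) (at 0)"
        by (rule tendsto_eq_intros refl)+ simp
      show ?case
      proof (cases "norm x < r")
        case True
        have "(H has_derivative H' x) (at (x + 0 *\<^sub>R e))"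
          using derivH[of x] True r by simp
        then have "((\<lambda>t. H (x + t *\<^sub>R e)) has_derivative (\<lambda>t. H' x (t *\<^sub>R e))) (at 0)"
          by (rule has_derivative_compose[rotated]) (auto intro!: derivative_eq_intros)
        moreover have "H' x (t *\<^sub>R e) = H' x e * t" for t
          using linear_scale[OF has_derivative_linear[OF derivH[of x]]] True r by simp
        ultimately have "((\<lambda>t. H (x + t *\<^sub>R e)) has_real_derivative f' x) (at 0)"
          using True by (simp add: has_field_derivative_def f'_def)
        moreover have "\<forall>\<^sub>F t in nhds 0. H (x + t *\<^sub>R e) = f (x + t *\<^sub>R e)"
        proof -
          have "open {t::real. norm (x + t *\<^sub>R e) < r}"
            by (intro open_Collect_less continuous_intros)
          then have "\<forall>\<^sub>F t in nhds 0. norm (x + t *\<^sub>R e) < r"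
            using True eventually_nhds_in_open[of "{t::real. norm (x + t *\<^sub>R e) < r}" 0] by auto
          then show ?thesis by eventually_elim (simp add: f_in)
        qed
        ultimately show ?thesis
          by (subst (asm) DERIV_cong_ev[OF refl _ refl])
      next
        case False
        then have *: "norm x > r" using elim by auto
        have "((\<lambda>t::real. 0) has_real_derivative f' x) (at 0)"
          using * by (simp add: f'_def)
        moreover have "\<forall>\<^sub>F t in nhds 0. 0 = f (x + t *\<^sub>R e)"
        proof -
          have "open {t::real. r < norm (x + t *\<^sub>R e)}"
            by (intro open_Collect_less continuous_intros)
          then have "\<forall>\<^sub>F t in nhds 0. r < norm (x + t *\<^sub>R e)"
            using * eventually_nhds_in_open[of "{t::real. r < norm (x + t *\<^sub>R e)}" 0] by auto
          then show ?thesis by eventually_elim (simp add: f_out)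
        qed
        ultimately show ?thesis
          by (subst (asm) DERIV_cong_ev[OF refl _ refl])
      qed
    qed
  qed
  moreover have "(LINT x|lborel. f' x) = (LINT x:ball 0 r|lborel. (r\<^sup>2 - (norm x)\<^sup>2) * F' x e) -
         (LINT x:ball 0 r|lborel. 2 * (x \<bullet> e) * F x)"
    unfolding set_integral_diff(2)[OF int[OF contA] int[OF contB], symmetric]
    by (simp add: set_lebesgue_integral_def f'_def H'_def)
  ultimately show ?thesis by simp
qed

lemma set_integral_Diff:
  fixes f :: "'a \<Rightarrow> 'b::{banach, second_countable_topology}"
  assumes "set_integrable M B f" "A \<in> sets M" "B \<in> sets M" "A \<subseteq> B"
  shows "(LINT x:B - A|M. f x) = (LINT x:B|M. f x) - (LINT x:A|M. f x)"
proof -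
  have "(LINT x:A \<union> (B - A)|M. f x) = (LINT x:A|M. f x) + (LINT x:B - A|M. f x)"
    by (intro set_integral_Un set_integrable_subset[OF assms(1)]) (use assms in auto)
  moreover have "A \<union> (B - A) = B" using assms by auto
  ultimately show ?thesis by simp
qed

text \<open>The derivative may be unbounded near the sphere of radius \<open>R\<close>, so the
  Lipschitz argument does not apply there directly. The identity is passed to the limit along inner
  radii, with \<open>R\<^sup>2 * norm (D x)\<close> dominating one side and
  \<open>norm (E x)\<close> the other.\<close>

lemma weighted_divergence_ball:
  fixes F :: "'a::euclidean_space \<Rightarrow> real"
  assumes R: "R > 0"
    and contF: "continuous_on (cball 0 R) F"
    and deriv: "\<And>x. x \<in> ball 0 R \<Longrightarrow> (F has_derivative F' x) (at x)"
    and cont: "\<And>b. b \<in> Basis \<Longrightarrow> continuous_on (ball 0 R) (\<lambda>x. F' x b)"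
    and int: "set_integrable lborel (ball 0 R) (\<lambda>x. F' x e)"
  shows "(LINT x:ball 0 R|lborel. (R\<^sup>2 - (norm x)\<^sup>2) * F' x e) =
         (LINT x:ball 0 R|lborel. 2 * (x \<bullet> e) * F x)"
proof -
  \<comment> \<open>The first radius is 0, which the identity on inner balls admits.\<close>
  define r where "r m = R * (1 - inverse (real (Suc m)))" for m
  have r: "0 \<le> r m" "r m < R" for m
    using R by (auto simp: r_def field_simps)
  have "r \<longlonglongrightarrow> R * (1 - 0)"
    unfolding r_def by (intro tendsto_intros LIMSEQ_inverse_real_of_nat)
  then have rlim: "r \<longlonglongrightarrow> R" by simp
  define D where "D x = indicator (ball 0 R) x * F' x e" for x
  define E where "E x = indicator (ball 0 R) x * (2 * (x \<bullet> e) * F x)" for x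
  have intD: "integrable lborel D"
    using int by (simp add: D_def[abs_def] set_integrable_def)
  have intE: "integrable lborel E"
  proof -
    have "set_integrable lborel (ball 0 R) (\<lambda>x. 2 * (x \<bullet> e) * F x)"
      by (rule set_integrable_cball_subset) (auto intro!: continuous_intros contF)
    then show ?thesis by (simp add: E_def[abs_def] set_integrable_def)
  qed
  have [measurable]: "ball (0::'a) s \<in> sets borel" for s by simp
  have in_ball: "\<forall>\<^sub>F m in sequentially. norm x < r m" if "norm x < R" for x :: 'a
    using order_tendstoD(1)[OF rlim that] .
  have "(\<lambda>m. LINT x|lborel. indicator (ball 0 (r m)) x * ((r m)\<^sup>2 - (norm x)\<^sup>2) * D x) \<longlonglongrightarrow>
        (LINT x|lborel. indicator (ball 0 R) x * (R\<^sup>2 - (norm x)\<^sup>2) * D x)"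
  proof (rule integral_dominated_convergence)
    show "integrable lborel (\<lambda>x. R\<^sup>2 * norm (D x))"
      using intD by auto
    note [measurable] = borel_measurable_integrable[OF intD]
    show "(\<lambda>x. indicator (ball 0 R) x * (R\<^sup>2 - (norm x)\<^sup>2) * D x) \<in> borel_measurable lborel"
      by measurable
    show "(\<lambda>x. indicator (ball 0 (r m)) x * ((r m)\<^sup>2 - (norm x)\<^sup>2) * D x) \<in> borel_measurable lborel" for m
      by measurable
    show "AE x in lborel. (\<lambda>m. indicator (ball 0 (r m)) x * ((r m)\<^sup>2 - (norm x)\<^sup>2) * D x)
        \<longlonglongrightarrow> indicator (ball 0 R) x * (R\<^sup>2 - (norm x)\<^sup>2) * D x"
    proof (rule AE_I2)
      fix x :: 'a
      show "(\<lambda>m. indicator (ball 0 (r m)) x * ((r m)\<^sup>2 - (norm x)\<^sup>2) * D x)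
        \<longlonglongrightarrow> indicator (ball 0 R) x * (R\<^sup>2 - (norm x)\<^sup>2) * D x"
      proof (cases "norm x < R")
        case True
        have "(\<lambda>m. ((r m)\<^sup>2 - (norm x)\<^sup>2) * D x) \<longlonglongrightarrow> (R\<^sup>2 - (norm x)\<^sup>2) * D x"
          by (intro tendsto_intros rlim)
        moreover have "\<forall>\<^sub>F m in sequentially. ((r m)\<^sup>2 - (norm x)\<^sup>2) * D x =
            indicator (ball 0 (r m)) x * ((r m)\<^sup>2 - (norm x)\<^sup>2) * D x"
          using in_ball[OF True] by eventually_elim simp
        ultimately show ?thesis
          using True by (simp add: Lim_transform_eventually)
      qed (simp add: D_def)
    qed
    show "AE x in lborel. norm (indicator (ball 0 (r m)) x * ((r m)\<^sup>2 - (norm x)\<^sup>2) * D x) \<le> R\<^sup>2 * norm (D x)" for m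
    proof (rule AE_I2)
      fix x :: 'a
      have "\<bar>(r m)\<^sup>2 - (norm x)\<^sup>2\<bar> \<le> R\<^sup>2" if "norm x < r m"
      proof -
        have "(norm x)\<^sup>2 \<le> (r m)\<^sup>2" "(r m)\<^sup>2 \<le> R\<^sup>2" "0 \<le> (norm x)\<^sup>2"
          using that r[of m] by (auto intro: power_mono)
        then show ?thesis by linarith
      qed
      then have "\<bar>indicator (ball 0 (r m)) x * ((r m)\<^sup>2 - (norm x)\<^sup>2)\<bar> \<le> R\<^sup>2"
        by (auto simp: indicator_def)
      from mult_right_mono[OF this, of "norm (D x)"]
      show "norm (indicator (ball 0 (r m)) x * ((r m)\<^sup>2 - (norm x)\<^sup>2) * D x) \<le> R\<^sup>2 * norm (D x)"
        by (simp add: abs_mult)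
    qed
  qed
  moreover have "(LINT x|lborel. indicator (ball 0 (r m)) x * ((r m)\<^sup>2 - (norm x)\<^sup>2) * D x) =
      (LINT x|lborel. indicator (ball 0 (r m)) x * E x)" for m
  proof -
    have sub: "ball 0 (r m) \<subseteq> ball (0::'a) R" using r[of m] by auto
    have "(LINT x|lborel. indicator (ball 0 (r m)) x * ((r m)\<^sup>2 - (norm x)\<^sup>2) * D x) =
        (LINT x:ball 0 (r m)|lborel. ((r m)\<^sup>2 - (norm x)\<^sup>2) * F' x e)"
      unfolding set_lebesgue_integral_def D_def
      by (intro Bochner_Integration.integral_cong refl) (use sub in \<open>auto simp: indicator_def\<close>)
    also have "\<dots> = (LINT x:ball 0 (r m)|lborel. 2 * (x \<bullet> e) * F x)"
      by (rule weighted_divergence_inner_ball[OF r deriv cont])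
    also have "\<dots> = (LINT x|lborel. indicator (ball 0 (r m)) x * E x)"
      unfolding set_lebesgue_integral_def E_def
      by (intro Bochner_Integration.integral_cong refl) (use sub in \<open>auto simp: indicator_def\<close>)
    finally show ?thesis .
  qed
  moreover have "(\<lambda>m. LINT x|lborel. indicator (ball 0 (r m)) x * E x) \<longlonglongrightarrow> (LINT x|lborel. E x)"
  proof (rule integral_dominated_convergence)
    show "integrable lborel (\<lambda>x. norm (E x))"
      using intE by auto
    note [measurable] = borel_measurable_integrable[OF intE]
    show "E \<in> borel_measurable lborel"
      by measurable
    show "(\<lambda>x. indicator (ball 0 (r m)) x * E x) \<in> borel_measurable lborel" for m
      by measurable
    show "AE x in lborel. (\<lambda>m. indicator (ball 0 (r m)) x * E x) \<longlonglongrightarrow> E x"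
    proof (rule AE_I2)
      fix x :: 'a
      show "(\<lambda>m. indicator (ball 0 (r m)) x * E x) \<longlonglongrightarrow> E x"
      proof (cases "norm x < R")
        case True
        have "\<forall>\<^sub>F m in sequentially. indicator (ball 0 (r m)) x * E x = E x"
          using in_ball[OF True] by eventually_elim simp
        then show ?thesis by (rule tendsto_eventually)
      qed (simp add: E_def)
    qed
    show "AE x in lborel. norm (indicator (ball 0 (r m)) x * E x) \<le> norm (E x)" for m
      by (auto simp: indicator_def)
  qed
  ultimately have "(LINT x|lborel. indicator (ball 0 R) x * (R\<^sup>2 - (norm x)\<^sup>2) * D x) = (LINT x|lborel. E x)"
    by (simp add: LIMSEQ_unique)
  moreover have "(LINT x|lborel. indicator (ball 0 R) x * (R\<^sup>2 - (norm x)\<^sup>2) * D x) =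
      (LINT x:ball 0 R|lborel. (R\<^sup>2 - (norm x)\<^sup>2) * F' x e)"
    unfolding set_lebesgue_integral_def D_def
    by (intro Bochner_Integration.integral_cong refl) (auto simp: indicator_def)
  ultimately show ?thesis by (simp add: E_def[abs_def] set_lebesgue_integral_def)
qed

section \<open>Surface integrals as limits of shell averages\<close>

text \<open>The radial projection in the definition of \<open>sphere_measure\<close> turns a surface
  integral into a volume integral of the function extended constantly along rays, and in this form
  it can be compared with integrals over shells.\<close>

lemma integral_sphere_measure:
  fixes G :: "'a::euclidean_space \<Rightarrow> real"
  assumes R: "R > 0" and G: "continuous_on (sphere 0 R) G"
  shows "(LINT x|sphere_measure R. G x) =
    real DIM('a) / R * (LINT x:ball 0 R - {0}|lborel. G ((R / norm x) *\<^sub>R x))"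
proof -
  let ?D = "distr (restrict_space lborel (ball 0 R - {0})) (restrict_space borel (sphere 0 R))
         (\<lambda>x. (R / norm x) *\<^sub>R x) :: 'a measure"
  have G': "G \<in> borel_measurable (restrict_space borel (sphere 0 R))"
    using G by (rule borel_measurable_continuous_on_restrict)
  have "(sphere_measure R :: 'a measure) = density ?D (\<lambda>_. ennreal (real DIM('a) / R))"
    unfolding sphere_measure_def
    by (rule measure_eqI) (auto simp: emeasure_density_const)
  then have "(LINT x|sphere_measure R. G x) = (LINT x|?D. real DIM('a) / R * G x)"
    using R G' by (simp add: integral_density)
  also have "\<dots> = real DIM('a) / R * (LINT x|?D. G x)" by simp
  also have "(LINT x|?D. G x) = (LINT x|restrict_space lborel (ball 0 R - {0}). G ((R / norm x) *\<^sub>R x))"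
    by (rule integral_distr[OF measurable_radial_projection[OF R] G'])
  also have "\<dots> = (LINT x:ball 0 R - {0}|lborel. G ((R / norm x) *\<^sub>R x))"
    unfolding set_lebesgue_integral_def by (rule integral_restrict_space) simp
  finally show ?thesis .
qed

lemma lborel_integral_scaleR:
  fixes f :: "'a::euclidean_space \<Rightarrow> real"
  assumes c: "c > 0" and [measurable]: "f \<in> borel_measurable borel"
  shows "(LINT x|lborel. f x) = c ^ DIM('a) * (LINT x|lborel. f (c *\<^sub>R x))"
proof -
  have "(LINT x|lborel. f x) =
      (LINT x|density (distr lborel borel (\<lambda>x. 0 + c *\<^sub>R x)) (\<lambda>_. ennreal (\<bar>c\<bar> ^ DIM('a))). f x)"
    using lborel_affine[of c "0::'a"] c by simp
  also have "\<dots> = (LINT x|distr lborel borel (\<lambda>x. c *\<^sub>R x). c ^ DIM('a) * f x)"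
    using c by (subst integral_density) auto
  also have "\<dots> = c ^ DIM('a) * (LINT x|lborel. f (c *\<^sub>R x))"
    by (subst integral_distr) auto
  finally show ?thesis .
qed

text \<open>Let \<open>g\<close> extend the boundary values of \<open>G\<close> constantly along
  rays. Integrals of \<open>g\<close> over centered balls scale exactly with the power
  \<open>DIM('a)\<close> of the radius, which settles the limit for \<open>g\<close>; on thin shells
  \<open>G - g\<close> is uniformly small. The factor \<open>1 / R\<close> appears because
  \<open>R\<^sup>2 - (a m)\<^sup>2\<close> behaves like \<open>2 * R * (R - a m)\<close>.\<close>

lemma shell_integral_tendsto_sphere_integral:
  fixes G :: "'a::euclidean_space \<Rightarrow> real"
  assumes R: "R > 0" and G: "continuous_on (cball 0 R) G"
    and a: "\<And>m. 0 < a m" "\<And>m. a m < R" and alim: "a \<longlonglongrightarrow> R"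
  shows "(\<lambda>m. 2 / (R\<^sup>2 - (a m)\<^sup>2) * (LINT x:ball 0 R - ball 0 (a m)|lborel. G x))
    \<longlonglongrightarrow> 1 / R * (LINT x|sphere_measure R. G x)"
proof -
  let ?n = "DIM('a)"
  \<comment> \<open>The origin has no radial projection. Cutting it out leaves a function continuous
    off the origin, hence Borel, and still invariant under positive scaling.\<close>
  define g where "g x = indicator (- {0}) x * G ((R / norm x) *\<^sub>R x)" for x
  define I where "I = (LINT x:ball 0 R|lborel. g x)"
  define V where "V = measure lborel (ball (0::'a) R)"
  \<comment> \<open>Volume scales like the integral of \<open>g\<close>, so the same factor relates
    the normalized shell to the full ball both for \<open>I\<close> and for
    \<open>V\<close>.\<close>
  define Q where "Q m = 2 * (1 - (a m / R) ^ ?n) / (R\<^sup>2 - (a m)\<^sup>2)" for m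
  have sq: "R\<^sup>2 - (a m)\<^sup>2 > 0" for m
    using power_strict_mono[of "a m" R 2] a[of m] by simp
  have "bounded (G ` cball 0 R)"
    using G by (intro compact_imp_bounded compact_continuous_image) auto
  then obtain B where B: "\<And>x. norm x \<le> R \<Longrightarrow> \<bar>G x\<bar> \<le> B"
    unfolding bounded_iff by fastforce
  have [measurable]: "ball (0::'a) s \<in> sets borel" for s by simp
  have "continuous_on (- {0}) (\<lambda>x::'a. G ((R / norm x) *\<^sub>R x))"
    using R by (intro continuous_on_compose2[OF G] continuous_intros) (auto split: if_splits)
  from borel_measurable_continuous_on_indicator[OF _ this]
  have g_meas [measurable]: "g \<in> borel_measurable borel" by (simp add: g_def[abs_def])
  have g_bd: "\<bar>g x\<bar> \<le> B" for x
    using B[of "(R / norm x) *\<^sub>R x"] B[of 0] R by (auto simp: g_def indicator_def)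
  have intg: "set_integrable lborel A g" if "A \<subseteq> cball 0 R" "A \<in> sets borel" for A
  proof -
    have "set_integrable lborel A (\<lambda>_. B)"
      using that by (intro set_integrable_cball_subset[of R]) auto
    then show ?thesis
      by (rule set_integrable_bound)
         (use that g_bd in \<open>auto simp: set_borel_measurable_def intro!: order_trans[OF g_bd]\<close>)
  qed
  have intG: "set_integrable lborel A G" if "A \<subseteq> cball 0 R" "A \<in> sets borel" for A
    using that G by (intro set_integrable_cball_subset)
  have sphere: "(LINT x|sphere_measure R. G x) = real ?n / R * I"
  proof -
    have "(LINT x|sphere_measure R. G x) =
      real ?n / R * (LINT x:ball 0 R - {0}|lborel. G ((R / norm x) *\<^sub>R x))"
      by (rule integral_sphere_measure[OF R continuous_on_subset[OF G]]) auto
    also have "(LINT x:ball 0 R - {0}|lborel. G ((R / norm x) *\<^sub>R x)) = I"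
      unfolding I_def set_lebesgue_integral_def g_def
      by (intro Bochner_Integration.integral_cong refl) (auto simp: indicator_def)
    finally show ?thesis .
  qed
  have g_ball: "(LINT x:ball 0 (a m)|lborel. g x) = (a m / R) ^ ?n * I" for m
  proof -
    have c: "a m / R > 0" using a R by simp
    have "(LINT x:ball 0 (a m)|lborel. g x) =
        (a m / R) ^ ?n * (LINT x|lborel. indicator (ball 0 (a m)) ((a m / R) *\<^sub>R x) * g ((a m / R) *\<^sub>R x))"
      unfolding set_lebesgue_integral_def real_scaleR_def
      by (rule lborel_integral_scaleR[OF c]) measurable
    also have "(LINT x|lborel. indicator (ball 0 (a m)) ((a m / R) *\<^sub>R x) * g ((a m / R) *\<^sub>R x)) = I"
      unfolding I_def set_lebesgue_integral_def real_scaleR_def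
    proof (intro Bochner_Integration.integral_cong refl arg_cong2[where f="(*)"])
      fix x :: 'a
      show "indicator (ball 0 (a m)) ((a m / R) *\<^sub>R x) = (indicator (ball 0 R) x :: real)"
        using a[of m] R by (auto simp: indicator_def field_simps)
      show "g ((a m / R) *\<^sub>R x) = g x"
        using a(1)[of m] R by (auto simp: g_def indicator_def)
    qed
    finally show ?thesis .
  qed
  have g_shell: "2 / (R\<^sup>2 - (a m)\<^sup>2) * (LINT x:ball 0 R - ball 0 (a m)|lborel. g x) = Q m * I" for m
  proof -
    have "(LINT x:ball 0 R - ball 0 (a m)|lborel. g x) = (1 - (a m / R) ^ ?n) * I"
      using a(2)[of m]
      by (subst set_integral_Diff) (auto intro!: intg simp: g_ball I_def left_diff_distrib)
    then show ?thesis by (simp add: Q_def)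
  qed
  have vol_shell: "2 / (R\<^sup>2 - (a m)\<^sup>2) * measure lborel (ball 0 R - ball (0::'a) (a m)) = Q m * V" for m
  proof -
    have "measure lborel (ball 0 R - ball (0::'a) (a m)) = V - measure lborel (ball (0::'a) (a m))"
      unfolding V_def using a[of m] emeasure_lborel_ball_finite
      by (subst measure_Diff) (auto simp: less_top[symmetric])
    also have "measure lborel (ball (0::'a) (a m)) = (a m / R) ^ ?n * V"
      unfolding V_def using a(1)[of m] R by (simp add: content_ball power_divide)
    also have "V - (a m / R) ^ ?n * V = (1 - (a m / R) ^ ?n) * V"
      by (simp add: left_diff_distrib)
    finally show ?thesis by (simp add: Q_def)
  qed
  have Qlim: "Q \<longlonglongrightarrow> real ?n / R\<^sup>2"
  proof -
    \<comment> \<open>Numerator and denominator share the factor \<open>1 - a m / R\<close>;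
      cancelling it removes the indeterminate form. In the limit the geometric sum is
      \<open>?n\<close> and the denominator is 2.\<close>
    have "Q = (\<lambda>m. 2 / R\<^sup>2 * (\<Sum>i<?n. (a m / R) ^ i) / (1 + a m / R))"
    proof
      fix m
      have "R\<^sup>2 - (a m)\<^sup>2 = R\<^sup>2 * (1 - a m / R) * (1 + a m / R)"
        using R by (simp add: field_simps power2_eq_square)
      moreover have "1 - a m / R > 0" "1 + a m / R > 0"
        using R a[of m] by (simp_all add: field_simps add_pos_pos)
      ultimately show "Q m = 2 / R\<^sup>2 * (\<Sum>i<?n. (a m / R) ^ i) / (1 + a m / R)"
        unfolding Q_def one_diff_power_eq[of "a m / R"] using R by simp
    qed
    moreover have "(\<lambda>m. 2 / R\<^sup>2 * (\<Sum>i<?n. (a m / R) ^ i) / (1 + a m / R))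
        \<longlonglongrightarrow> 2 / R\<^sup>2 * (\<Sum>i<?n. (R / R) ^ i) / (1 + R / R)"
      using R by (intro tendsto_intros alim) auto
    ultimately show ?thesis using R by (simp add: mult.commute)
  qed
  have Vpos: "V \<ge> 0" by (simp add: V_def)
  define d where "d m = 2 / (R\<^sup>2 - (a m)\<^sup>2) * (LINT x:ball 0 R - ball 0 (a m)|lborel. G x - g x)" for m
  have "d \<longlonglongrightarrow> 0"
  proof (rule LIMSEQ_I)
    fix \<epsilon> :: real assume \<epsilon>: "\<epsilon> > 0"
    \<comment> \<open>The product is an eventual bound for \<open>Q m * V\<close>; the final 1 makes
      \<open>C\<close> positive and the closing estimate strict.\<close>
    define C where "C = (real ?n / R\<^sup>2 + 1) * V + 1"
    have "0 \<le> (real ?n / R\<^sup>2 + 1) * V"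
      using Vpos by (intro mult_nonneg_nonneg add_nonneg_nonneg divide_nonneg_nonneg) auto
    then have C: "C > 0" unfolding C_def by linarith
    have "uniformly_continuous_on (cball 0 R) G"
      using G by (intro compact_uniformly_continuous) auto
    then obtain \<delta> where \<delta>: "\<delta> > 0"
      "\<And>x y. x \<in> cball 0 R \<Longrightarrow> y \<in> cball 0 R \<Longrightarrow> dist y x < \<delta> \<Longrightarrow> dist (G y) (G x) < \<epsilon> / C"
      unfolding uniformly_continuous_on_def using divide_pos_pos[OF \<epsilon> C] by blast
    have "\<forall>\<^sub>F m in sequentially. R - \<delta> < a m"
      using order_tendstoD(1)[OF alim] \<delta>(1) by simp
    moreover have "\<forall>\<^sub>F m in sequentially. Q m < real ?n / R\<^sup>2 + 1"
      using order_tendstoD(2)[OF Qlim] by simp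
    ultimately have "\<forall>\<^sub>F m in sequentially. norm (d m - 0) < \<epsilon>"
    proof eventually_elim
      case (elim m)
      let ?S = "ball 0 R - ball (0::'a) (a m)"
      have S: "?S \<subseteq> cball 0 R" "?S \<in> sets borel" by auto
      have int: "set_integrable lborel ?S (\<lambda>x. G x - g x)"
        by (intro set_integral_diff intG intg S)
      have "norm (LINT x:?S|lborel. G x - g x) \<le> (LINT x:?S|lborel. norm (G x - g x))"
        by (rule set_integral_norm_bound[OF int])
      also have "\<dots> \<le> (LINT x:?S|lborel. \<epsilon> / C)"
      proof (rule set_integral_mono)
        show "set_integrable lborel ?S (\<lambda>x. norm (G x - g x))"
          using set_integrable_norm[OF int] .
        show "set_integrable lborel ?S (\<lambda>x. \<epsilon> / C)"
          using S by (intro set_integrable_cball_subset) auto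
        fix x assume x: "x \<in> ?S"
        have x0: "x \<noteq> 0" using x a[of m] by auto
        \<comment> \<open>A point of the shell has distance \<open>R - norm x\<close> from its
          radial projection, so the thickness of the shell controls \<open>G x - g x\<close> through
          uniform continuity.\<close>
        have "x - (R / norm x) *\<^sub>R x = (1 - R / norm x) *\<^sub>R x"
          by (simp add: scaleR_diff_left)
        then have "dist x ((R / norm x) *\<^sub>R x) = \<bar>1 - R / norm x\<bar> * norm x"
          by (simp add: dist_norm)
        also have "\<dots> = R - norm x"
          using x x0 by (simp add: abs_if field_simps)
        also have "\<dots> < \<delta>" using x elim by auto
        finally have "dist (G x) (G ((R / norm x) *\<^sub>R x)) < \<epsilon> / C"
          using x x0 R by (intro \<delta>(2)) auto
        then show "norm (G x - g x) \<le> \<epsilon> / C"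
          using x0 by (simp add: g_def dist_norm)
      qed
      also have "\<dots> = \<epsilon> / C * measure lborel ?S"
        using emeasure_mono[of ?S "ball 0 R" lborel] emeasure_lborel_ball_finite[of "0::'a" R]
        by (subst set_integral_const) (auto simp: mult.commute top_unique)
      finally have *: "norm (LINT x:?S|lborel. G x - g x) \<le> \<epsilon> / C * measure lborel ?S" .
      have "norm (d m) = 2 / (R\<^sup>2 - (a m)\<^sup>2) * norm (LINT x:?S|lborel. G x - g x)"
        unfolding d_def norm_mult using sq[of m] by simp
      also have "\<dots> \<le> 2 / (R\<^sup>2 - (a m)\<^sup>2) * (\<epsilon> / C * measure lborel ?S)"
        using sq[of m] by (intro mult_left_mono *) auto
      finally have "norm (d m) \<le> 2 / (R\<^sup>2 - (a m)\<^sup>2) * (\<epsilon> / C * measure lborel ?S)" .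
      also have "\<dots> = \<epsilon> / C * (Q m * V)"
        unfolding vol_shell[symmetric] by (simp add: mult_ac)
      also have "\<dots> \<le> \<epsilon> / C * ((real ?n / R\<^sup>2 + 1) * V)"
        using elim Vpos \<epsilon> C by (intro mult_left_mono mult_right_mono) auto
      also have "\<dots> < \<epsilon> / C * C"
        using \<epsilon> C by (intro mult_strict_left_mono divide_pos_pos) (simp_all add: C_def)
      also have "\<dots> = \<epsilon>" using C by simp
      finally show ?case by simp
    qed
    then show "\<exists>no. \<forall>m\<ge>no. norm (d m - 0) < \<epsilon>"
      by (simp add: eventually_sequentially)
  qed
  then have "(\<lambda>m. d m + Q m * I) \<longlonglongrightarrow> 0 + real ?n / R\<^sup>2 * I"
    by (intro tendsto_intros Qlim)
  moreover have "d m + Q m * I = 2 / (R\<^sup>2 - (a m)\<^sup>2) * (LINT x:ball 0 R - ball 0 (a m)|lborel. G x)" for m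
  proof -
    have S: "ball 0 R - ball (0::'a) (a m) \<subseteq> cball 0 R" by auto
    show ?thesis
      unfolding d_def g_shell[symmetric] distrib_left[symmetric]
      using set_integral_diff(2)[OF intG[OF S] intg[OF S]] by simp
  qed
  moreover have "0 + real ?n / R\<^sup>2 * I = 1 / R * (LINT x|sphere_measure R. G x)"
    unfolding sphere by (simp add: power2_eq_square)
  ultimately show ?thesis by simp
qed

section \<open>The divergence theorem with continuous boundary values\<close>

text \<open>The difference of the weights for \<open>R\<close> and \<open>a m\<close>, divided by
  \<open>R\<^sup>2 - (a m)\<^sup>2\<close>, is a cutoff: it equals 1 on the inner ball and decreases
  to 0 at the outer sphere. Subtracting the weighted identities moves the derivative onto the cutoff
  and leaves a normalized integral over the shell, whose limit is the surface term. The factor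
  \<open>1 / R\<close> normalizes the outward normal.\<close>

theorem divergence_theorem_ball:
  fixes F :: "'a::euclidean_space \<Rightarrow> real"
  assumes R: "R > 0"
    and contF: "continuous_on (cball 0 R) F"
    and deriv: "\<And>x. x \<in> ball 0 R \<Longrightarrow> (F has_derivative F' x) (at x)"
    and cont: "\<And>b. b \<in> Basis \<Longrightarrow> continuous_on (ball 0 R) (\<lambda>x. F' x b)"
    and int: "set_integrable lborel (ball 0 R) (\<lambda>x. F' x e)"
  shows "(LINT x:ball 0 R|lborel. F' x e) = 1 / R * (LINT x|sphere_measure R. (x \<bullet> e) * F x)"
proof -
  \<comment> \<open>Two successors make \<open>R / 2\<close> the first radius; the rescaling behind
    the shell limit needs positive radii.\<close>
  define a where "a m = R * (1 - inverse (real (Suc (Suc m))))" for m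
  have a: "0 < a m" "a m < R" for m
    using R by (auto simp: a_def field_simps intro: add_pos_nonneg)
  have "a \<longlonglongrightarrow> R * (1 - 0)"
    unfolding a_def by (intro tendsto_intros LIMSEQ_Suc[OF LIMSEQ_inverse_real_of_nat])
  then have alim: "a \<longlonglongrightarrow> R" by simp
  define c where "c m = 1 / (R\<^sup>2 - (a m)\<^sup>2)" for m
  have sq: "R\<^sup>2 - (a m)\<^sup>2 > 0" for m
    using power_strict_mono[of "a m" R 2] a[of m] by simp
  define D where "D x = indicator (ball 0 R) x * F' x e" for x
  \<comment> \<open>Extending the weight by zero puts the integrals for both radii on the whole
    space, where they can be subtracted.\<close>
  define w where "w s x = indicator (ball 0 s) x * (s\<^sup>2 - (norm x)\<^sup>2)" for s :: real and x :: 'a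
  have intD: "integrable lborel D"
    using int by (simp add: D_def[abs_def] set_integrable_def)
  note [measurable] = borel_measurable_integrable[OF intD]
  have [measurable]: "ball (0::'a) s \<in> sets borel" for s by simp
  have w_meas [measurable]: "w s \<in> borel_measurable borel" for s
    unfolding w_def[abs_def] by measurable
  have w_bd: "\<bar>w s x\<bar> \<le> s\<^sup>2" if "s > 0" for s x
  proof (cases "norm x < s")
    case True
    then have "(norm x)\<^sup>2 \<le> s\<^sup>2" by (intro power_mono) auto
    then show ?thesis using True by (simp add: w_def)
  qed (simp add: w_def)
  have int_wD: "integrable lborel (\<lambda>x. w s x * D x)" if "s > 0" for s
  proof (rule Bochner_Integration.integrable_bound)
    show "integrable lborel (\<lambda>x. s\<^sup>2 * D x)" using intD by simp
    show "(\<lambda>x. w s x * D x) \<in> borel_measurable lborel" by measurable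
    show "AE x in lborel. norm (w s x * D x) \<le> norm (s\<^sup>2 * D x)"
      using w_bd[OF that] by (auto simp: abs_mult intro!: mult_right_mono)
  qed
  have contG: "continuous_on (cball 0 R) (\<lambda>x. (x \<bullet> e) * F x)"
    by (intro continuous_intros contF)
  have int_G: "set_integrable lborel (ball 0 R) (\<lambda>x. 2 * (x \<bullet> e) * F x)"
    by (intro set_integrable_cball_subset[of R] continuous_intros contF) auto
  have wD_eq: "(LINT x|lborel. w s x * D x) = (LINT x:ball 0 s|lborel. (s\<^sup>2 - (norm x)\<^sup>2) * F' x e)"
    if "s \<le> R" for s
    unfolding set_lebesgue_integral_def D_def w_def
    by (intro Bochner_Integration.integral_cong refl) (use that in \<open>auto simp: indicator_def\<close>)
  have "(LINT x|lborel. c m * (w R x - w (a m) x) * D x) =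
      2 / (R\<^sup>2 - (a m)\<^sup>2) * (LINT x:ball 0 R - ball 0 (a m)|lborel. (x \<bullet> e) * F x)" for m
  proof -
    have "(LINT x|lborel. c m * (w R x - w (a m) x) * D x) =
        c m * ((LINT x|lborel. w R x * D x) - (LINT x|lborel. w (a m) x * D x))"
      using int_wD[OF R] int_wD[OF a(1)[of m]] by (simp add: left_diff_distrib mult.assoc)
    also have "(LINT x|lborel. w R x * D x) = (LINT x:ball 0 R|lborel. 2 * (x \<bullet> e) * F x)"
      unfolding wD_eq[OF order_refl]
      by (rule weighted_divergence_ball[OF R contF deriv cont int])
    also have "(LINT x|lborel. w (a m) x * D x) = (LINT x:ball 0 (a m)|lborel. 2 * (x \<bullet> e) * F x)"
      unfolding wD_eq[OF less_imp_le[OF a(2)[of m]]]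
      by (rule weighted_divergence_inner_ball[OF less_imp_le[OF a(1)[of m]] a(2)[of m] deriv cont])
    also have "(LINT x:ball 0 R|lborel. 2 * (x \<bullet> e) * F x) - (LINT x:ball 0 (a m)|lborel. 2 * (x \<bullet> e) * F x) =
        (LINT x:ball 0 R - ball 0 (a m)|lborel. 2 * (x \<bullet> e) * F x)"
      using a(2)[of m] by (subst set_integral_Diff[OF int_G]) auto
    also have "\<dots> = 2 * (LINT x:ball 0 R - ball 0 (a m)|lborel. (x \<bullet> e) * F x)"
      by (simp add: mult.assoc)
    finally show ?thesis by (simp add: c_def)
  qed
  moreover have "(\<lambda>m. 2 / (R\<^sup>2 - (a m)\<^sup>2) * (LINT x:ball 0 R - ball 0 (a m)|lborel. (x \<bullet> e) * F x))
      \<longlonglongrightarrow> 1 / R * (LINT x|sphere_measure R. (x \<bullet> e) * F x)"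
    by (rule shell_integral_tendsto_sphere_integral[OF R contG a alim])
  moreover have "(\<lambda>m. LINT x|lborel. c m * (w R x - w (a m) x) * D x) \<longlonglongrightarrow> (LINT x|lborel. D x)"
  proof (rule integral_dominated_convergence)
    show "integrable lborel (\<lambda>x. norm (D x))" using intD by simp
    show "D \<in> borel_measurable lborel" by measurable
    show "(\<lambda>x. c m * (w R x - w (a m) x) * D x) \<in> borel_measurable lborel" for m by measurable
    have inner: "c m * (w R x - w (a m) x) = 1" if "norm x < a m" for x m
      using that a[of m] sq[of m] by (simp add: w_def c_def)
    show "AE x in lborel. (\<lambda>m. c m * (w R x - w (a m) x) * D x) \<longlonglongrightarrow> D x"
    proof (rule AE_I2)
      fix x :: 'a
      show "(\<lambda>m. c m * (w R x - w (a m) x) * D x) \<longlonglongrightarrow> D x"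
      proof (cases "norm x < R")
        case True
        have "\<forall>\<^sub>F m in sequentially. norm x < a m"
          using order_tendstoD(1)[OF alim True] .
        then have "\<forall>\<^sub>F m in sequentially. c m * (w R x - w (a m) x) * D x = D x"
          by eventually_elim (simp add: inner)
        then show ?thesis by (rule tendsto_eventually)
      qed (simp add: D_def)
    qed
    show "AE x in lborel. norm (c m * (w R x - w (a m) x) * D x) \<le> norm (D x)" for m
    proof (rule AE_I2)
      fix x :: 'a
      show "norm (c m * (w R x - w (a m) x) * D x) \<le> norm (D x)"
      proof (cases "norm x < a m")
        case True then show ?thesis by (simp add: inner)
      next
        case False
        show ?thesis
        proof (cases "norm x < R")
          case True
          \<comment> \<open>Between the two radii only the outer weight survives, and the cutoff is
            a quotient between 0 and 1.\<close>
          have "(a m)\<^sup>2 \<le> (norm x)\<^sup>2" "(norm x)\<^sup>2 \<le> R\<^sup>2"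
            using False True a[of m] by (auto intro!: power_mono)
          then have "\<bar>c m * (w R x - w (a m) x)\<bar> \<le> 1"
            using False True sq[of m] by (simp add: w_def c_def)
          from mult_right_mono[OF this, of "norm (D x)"] show ?thesis
            by (simp add: abs_mult)
        qed (simp add: D_def)
      qed
    qed
  qed
  ultimately have "(LINT x|lborel. D x) = 1 / R * (LINT x|sphere_measure R. (x \<bullet> e) * F x)"
    by (simp add: LIMSEQ_unique)
  then show ?thesis by (simp add: D_def[abs_def] set_lebesgue_integral_def)
qed

section \<open>The weighted inequality\<close>

text \<open>Smoothness on the open ball gives no values on the sphere, so continuity on the closed
  ball fixes what the surface integral means. The nonnegative integrals on the larger side may be
  infinite, as the gradient may grow near the boundary. The factor \<open>1 / R\<close> comes from
  the unit normal \<open>x / R\<close>; constant functions, for which the gradient vanishes, show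
  that the two terms must cancel with exactly this factor.\<close>

theorem corollary2p19:
  fixes \<phi> :: "real ^ 'n::finite \<Rightarrow> complex"
    and R :: real
    and k :: 'n
  assumes R: "R > 0"
    and smooth: "smooth_on (ball 0 R) \<phi>"
    and boundary_values: "continuous_on (cball 0 R) \<phi>"
  shows
    "(\<integral>\<^sup>+x\<in>ball 0 R. ennreal ((norm (gradient \<phi> x))\<^sup>2) \<partial>lborel) *
     (\<integral>\<^sup>+x\<in>ball 0 R. ennreal ((x $ k)\<^sup>2 * (cmod (\<phi> x))\<^sup>2) \<partial>lborel)
     \<ge> ennreal (1 / 4 *
         ((LINT x:ball 0 R|lborel. (cmod (\<phi> x))\<^sup>2) -
          1 / R * (LINT x|sphere_measure R. (x $ k)\<^sup>2 * (cmod (\<phi> x))\<^sup>2))\<^sup>2)"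
    (is "?A * ?B \<ge> ennreal (1 / 4 * ?T\<^sup>2)")
proof (cases "?A * ?B = \<infinity>")
  \<comment> \<open>Only this case has content; finiteness of the product is what makes
    \<open>q\<close> integrable, as the divergence theorem requires.\<close>
  case False
  let ?U = "ball (0 :: real ^ 'n) R"
  let ?d = "partial_deriv k \<phi>"
  \<comment> \<open>The inner product is the real one on the complex plane, that is, half the
    derivative of the squared modulus in direction \<open>k\<close>.\<close>
  define q where "q x = x $ k * (\<phi> x \<bullet> ?d x)" for x
  \<comment> \<open>With values in \<open>ennreal\<close>, Cauchy-Schwarz applies before any
    integrability is known. The weight \<open>\<bar>x $ k\<bar>\<close> is assigned to the factor
    \<open>v\<close> without derivatives.\<close>
  define u where "u x = indicator ?U x * ennreal (cmod (?d x))" for x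
  define v where "v x = indicator ?U x * ennreal (\<bar>x $ k\<bar> * cmod (\<phi> x))" for x
  have C1: "Ck_on (Suc 0) ?U \<phi>"
    using smooth unfolding smooth_on_def by blast
  then have deriv\<phi>: "(\<phi> has_derivative frechet_derivative \<phi> (at x)) (at x)" if "x \<in> ?U" for x
    using that by (simp flip: frechet_derivative_works)
  have cont_d: "continuous_on ?U (partial_deriv i \<phi>)" for i
    using C1 by simp
  have cont\<phi>: "continuous_on ?U \<phi>"
    by (rule continuous_on_subset[OF boundary_values]) auto
  have [measurable]: "?U \<in> sets borel" by simp
  have indicator_meas: "(\<lambda>x. indicator ?U x * f x) \<in> borel_measurable borel"
    if "continuous_on ?U f" for f :: "_ \<Rightarrow> real"
    using borel_measurable_continuous_on_indicator[OF _ that] by simp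
  have "(\<lambda>x. ennreal (indicator ?U x * cmod (?d x))) \<in> borel_measurable borel"
    by (intro measurable_compose[OF _ measurable_ennreal] indicator_meas continuous_intros cont_d)
  then have u_meas [measurable]: "u \<in> borel_measurable lborel"
    by (simp add: u_def[abs_def] ennreal_mult'' ennreal_indicator)
  have "(\<lambda>x. ennreal (indicator ?U x * (\<bar>x $ k\<bar> * cmod (\<phi> x)))) \<in> borel_measurable borel"
    by (intro measurable_compose[OF _ measurable_ennreal] indicator_meas continuous_intros cont\<phi>)
  then have v_meas [measurable]: "v \<in> borel_measurable lborel"
    by (simp add: v_def[abs_def] ennreal_mult'' ennreal_indicator)
  have uv: "(\<integral>\<^sup>+x. u x * v x \<partial>lborel)\<^sup>2 \<le> ?A * ?B"
  proof -
    have "(\<integral>\<^sup>+x. u x * v x \<partial>lborel)\<^sup>2 \<le> (\<integral>\<^sup>+x. u x ^ 2 \<partial>lborel) * (\<integral>\<^sup>+x. v x ^ 2 \<partial>lborel)"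
      by (rule Cauchy_Schwarz_nn_integral[OF u_meas v_meas])
    also have "\<dots> \<le> ?A * ?B"
    proof (intro mult_mono nn_integral_mono)
      fix x
      \<comment> \<open>A single component of the gradient enters the argument; the others are added
        only to reach the full norm.\<close>
      have "cmod (?d x) \<le> norm (gradient \<phi> x)"
        using Finite_Cartesian_Product.norm_nth_le[of "gradient \<phi> x" k] by (simp add: gradient_def)
      then show "u x ^ 2 \<le> ennreal ((norm (gradient \<phi> x))\<^sup>2) * indicator ?U x"
        by (auto simp: u_def indicator_def ennreal_power intro!: ennreal_leI power_mono)
      show "v x ^ 2 \<le> ennreal ((x $ k)\<^sup>2 * (cmod (\<phi> x))\<^sup>2) * indicator ?U x"
        by (auto simp: v_def indicator_def ennreal_power power_mult_distrib)
    qed auto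
    finally show ?thesis .
  qed
  have q_le: "(\<integral>\<^sup>+x. ennreal (norm (indicator ?U x * q x)) \<partial>lborel) \<le> (\<integral>\<^sup>+x. u x * v x \<partial>lborel)"
  proof (rule nn_integral_mono)
    fix x
    have "\<bar>q x\<bar> \<le> \<bar>x $ k\<bar> * (cmod (\<phi> x) * cmod (?d x))"
      unfolding q_def abs_mult by (intro mult_left_mono Cauchy_Schwarz_ineq2) auto
    then show "ennreal (norm (indicator ?U x * q x)) \<le> u x * v x"
      by (auto simp: u_def v_def indicator_def mult_ac intro!: ennreal_leI simp flip: ennreal_mult)
  qed
  \<comment> \<open>Only the product of the two integrals is known to be finite, so finiteness is
    drawn from the bound on the square rather than from either factor.\<close>
  have uv_fin: "(\<integral>\<^sup>+x. u x * v x \<partial>lborel) < \<infinity>"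
  proof (rule ccontr)
    assume "\<not> (\<integral>\<^sup>+x. u x * v x \<partial>lborel) < \<infinity>"
    then have "(\<integral>\<^sup>+x. u x * v x \<partial>lborel) = \<infinity>"
      by (simp flip: less_top)
    with uv have "?A * ?B = \<infinity>"
      by (simp add: power2_eq_square ennreal_top_mult top_unique)
    with False show False ..
  qed
  have q_int: "set_integrable lborel ?U q"
    unfolding set_integrable_def integrable_iff_bounded real_scaleR_def
  proof
    show "(\<lambda>x. indicator ?U x * q x) \<in> borel_measurable lborel"
      unfolding q_def using indicator_meas[of q] cont\<phi> cont_d
      by (simp add: q_def[abs_def] continuous_intros)
    show "(\<integral>\<^sup>+x. ennreal (norm (indicator ?U x * q x)) \<partial>lborel) < \<infinity>"
      using q_le uv_fin by (rule le_less_trans)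
  qed
  define F where "F x = x $ k * (\<phi> x \<bullet> \<phi> x)" for x
  \<comment> \<open>Writing the squared modulus as an inner product gives a product rule that also
    holds at zeros of the function.\<close>
  define F' where "F' x v = v $ k * (\<phi> x \<bullet> \<phi> x) + x $ k * (2 * (\<phi> x \<bullet> frechet_derivative \<phi> (at x) v))" for x v
  have F'_axis: "F' x (axis i 1) = axis i 1 $ k * (\<phi> x \<bullet> \<phi> x) + x $ k * (2 * (\<phi> x \<bullet> partial_deriv i \<phi> x))" for x i
    by (simp add: F'_def partial_deriv_def)
  have F'_k: "F' x (axis k 1) = (cmod (\<phi> x))\<^sup>2 + 2 * q x" for x
    by (simp add: F'_axis q_def power2_norm_eq_inner)
  have \<phi>2_int: "set_integrable lborel ?U (\<lambda>x. (cmod (\<phi> x))\<^sup>2)"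
    by (intro set_integrable_cball_subset[of R] continuous_intros boundary_values) auto
  have F'_int: "set_integrable lborel ?U (\<lambda>x. F' x (axis k 1))"
    unfolding F'_k using q_int \<phi>2_int by (intro set_integral_add) auto
  have "(LINT x:?U|lborel. F' x (axis k 1)) = 1 / R * (LINT x|sphere_measure R. (x \<bullet> axis k 1) * F x)"
  proof (rule divergence_theorem_ball[where F' = F', OF R])
    show "continuous_on (cball 0 R) F"
      unfolding F_def[abs_def] by (intro continuous_intros boundary_values)
    show "(F has_derivative F' x) (at x)" if "x \<in> ?U" for x
      unfolding F_def[abs_def] F'_def[abs_def]
      by (rule derivative_eq_intros deriv\<phi>[OF that] refl
          bounded_linear_imp_has_derivative[OF bounded_linear_vec_nth])+ (auto simp: fun_eq_iff inner_commute)
    show "continuous_on ?U (\<lambda>x. F' x b)" if "b \<in> Basis" for b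
    proof -
      obtain i where "b = axis i 1" using \<open>b \<in> Basis\<close> by (auto simp: Basis_vec_def)
      then show ?thesis by (simp only: F'_axis) (intro continuous_intros cont\<phi> cont_d)
    qed
  qed (rule F'_int)
  moreover have "(LINT x:?U|lborel. F' x (axis k 1)) = (LINT x:?U|lborel. (cmod (\<phi> x))\<^sup>2) + 2 * (LINT x:?U|lborel. q x)"
    unfolding F'_k using q_int \<phi>2_int by (subst set_integral_add) auto
  moreover have "(x \<bullet> axis k 1) * F x = (x $ k)\<^sup>2 * (cmod (\<phi> x))\<^sup>2" for x
    by (simp add: F_def inner_axis dot_square_norm power2_eq_square)
  ultimately have T: "?T = - 2 * (LINT x:?U|lborel. q x)" by simp
  \<comment> \<open>The constant \<open>1 / 4\<close> cancels the square of the factor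
    \<open>- 2\<close>.\<close>
  have "1 / 4 * ?T\<^sup>2 = (norm (LINT x:?U|lborel. q x))\<^sup>2"
    unfolding T by (simp add: power_mult_distrib)
  then have "ennreal (1 / 4 * ?T\<^sup>2) = (ennreal (norm (LINT x:?U|lborel. q x)))\<^sup>2"
    by (simp only: ennreal_power norm_ge_zero)
  also have "\<dots> \<le> (\<integral>\<^sup>+x. u x * v x \<partial>lborel)\<^sup>2"
  proof (rule power_mono)
    have "ennreal (norm (LINT x:?U|lborel. q x)) \<le> (\<integral>\<^sup>+x. ennreal (norm (indicator ?U x * q x)) \<partial>lborel)"
      using integral_norm_bound_ennreal[of lborel "\<lambda>x. indicator ?U x * q x"] q_int
      by (simp add: set_lebesgue_integral_def set_integrable_def)
    then show "ennreal (norm (LINT x:?U|lborel. q x)) \<le> (\<integral>\<^sup>+x. u x * v x \<partial>lborel)"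
      using q_le by (rule order_trans)
  qed simp
  also have "\<dots> \<le> ?A * ?B" by (rule uv)
  finally show ?thesis .
qed simp

end
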